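(* Let $p\ge 3$ be an odd integer. For every non-trivial element $g\in\mathcal{F}_p$ of the $p$-colorable subgroup of Thompson's group $F$, the knot or link $\mathcal{L}(g)$ obtained from $g$ by Jones' construction is $p$-colorable, i.e. its diagram admits a non-trivial Dehn $p$-coloring.
   Context: **Thompson's group $F$.** Binary trees are finite rooted ordered trees in which each vertex has either $0$ children (a leaf) or exactly two children; a caret is an internal vertex together with its two child edges. Label the left child edge by $0$ and the right child edge by $1$; each vertex, in particular each leaf, is identified with the word in $W_2$ (finite words on $\{0,1\}$) read along the path from the root. Leaves are numbered $0,1,2,\dots$ from left to right (lexicographic order). A tree pair (tree diagram) $(T_+,T_-)$ is a pair of binary trees with the same number of leaves; $i_+$ and $i_-$ denote the $i$-th leaves of $T_+$ and $T_-$. Insertion attaches a caret to leaf $i_+$ of $T_+$ and to leaf $i_-$ of $T_-$ (same $i$); reduction is the inverse. $F$ is the set of tree pairs modulo the equivalence relation generated by insertions and reductions, with product $[(A_+,A_-)][(A_-,B_-)]=[(A_+,B_-)]$ (representatives with matching middle tree can always be found by insertions). The identity is the class of $(T,T)$. Every class contains a unique reduced pair (one admitting no reduction). **The subgroup $\mathcal{F}_p$.** Put $\rho(a_1\cdots a_m)=\sum_{i=1}^m a_i/2^i\in\mathbb{Z}[1/2]$. Since $p$ is odd, elements of $\mathbb{Z}[1/2]$ can be reduced modulo $p$. Define $\mathcal{F}_p=\{(T_+,T_-)\in F\mid \rho(i_+)\equiv\rho(i_-) \pmod p \text{ for all } i\ge 0\}$ (the condition does not depend on the chosen representative). **Jones'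 construction $\mathcal{L}(g)$.** Let $(T_+,T_-)$ be the reduced tree pair of $g$. Draw $T_+$ in the upper half plane with root on top and $T_-$ in the lower half plane with root at the bottom, and glue the $i$-th leaf of $T_+$ to the $i$-th leaf of $T_-$ for every $i$, all on the horizontal axis; glued leaves are no longer vertices but interior points of edges. For each bounded region of this plane graph (the region between consecutive leaves $i$ and $i+1$), its boundary contains both child edges of exactly one caret of $T_+$ (the one at the lowest common ancestor of $i_+$ and $(i+1)_+$) and of exactly one caret of $T_-$; join the roots of these two carets by an edge (the "middle edge") inside the region. In the unbounded region, join the root of $T_+$ to the root of $T_-$ by an edge leaving the root of $T_+$ upward, passing around the right side of the diagram, and arriving at the root of $T_-$ from below (passing on the left instead gives a diagram of the same link). The result is a 4-valent plane graph $\mathcal{B}(T_+,T_-)$: at each vertex there are the two child edges (left and right), the middle edge between them, and, opposite the middle edge, the edge to the parent (or, at a root, the edge in the unbounded region). Regard this as a link projection, in which at each vertex one strand runs along the left and right child edges and the other strand runs along the parent edge and the middle edge. Turn every vertex, of $T_+$ and of $T_-$ alike, into a crossing in which the strand through the left and right child edges passes over the other. (Using the opposite convention at all vertices gives the mirror image, which has the same $p$-colorability.) The resulting link diagram is $\mathcal{L}(T_+,T_-)=\mathcal{L}(g)$. **Dehn $p$-coloring.** A Dehn $p$-coloring of a link diagram $D$ assigns an element of $\mathbb{Z}/p\mathbb{Z}$ to each region of the plane cut out by $D$ such that the unbounded region gets $0$, and at each crossing $a+b\equiv c+d\pmod p$, where $a,b$ are the colors of the two regions on one side of the under-strand (they are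 separated from each other by the over-strand) and $c,d$ are the colors of the two regions on the other side of the under-strand. Color the regions of $D$ checkerboard fashion with the unbounded region white. A Dehn $p$-coloring is trivial if every white region has color $0$ and all black regions have one and the same color $a\in\mathbb{Z}/p\mathbb{Z}$. A diagram is Dehn $p$-colorable if it has a non-trivial Dehn $p$-coloring; this is a link invariant, and a link is called $p$-colorable if its diagrams are Dehn $p$-colorable. *)

theory Defs
  imports
    Complex_Main
    "HOL-Library.Sublist"
    "HOL-Number_Theory.Cong"
    "HOL-Algebra.Group"
begin

section \<open>Binary trees and Thompson's group\<close>

datatype btree = Leaf | Caret btree btree

text \<open>Words on \<open>{0,1}\<close>; \<open>False\<close> is the letter 0 (left), \<open>True\<close> the letter 1 (right).\<close>
type_synonym word = "bool list"

text \<open>The leaves from left to right; the \<open>i\<close>-th leaf of \<open>T\<close> is \<open>leaves T ! i\<close>.\<close>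
fun leaves :: "btree \<Rightarrow> word list" where
  "leaves Leaf = [[]]"
| "leaves (Caret l r) = map ((#) False) (leaves l) @ map ((#) True) (leaves r)"

text \<open>The roots of the carets, i.e. the internal vertices.\<close>
fun carets :: "btree \<Rightarrow> word set" where
  "carets Leaf = {}"
| "carets (Caret l r) = insert [] ((#) False ` carets l \<union> (#) True ` carets r)"

abbreviation num_leaves :: "btree \<Rightarrow> nat" where
  "num_leaves T \<equiv> length (leaves T)"

text \<open>Attach a caret to the \<open>i\<close>-th leaf (intended for \<open>i < num_leaves T\<close>).\<close>
fun attach_caret :: "nat \<Rightarrow> btree \<Rightarrow> btree" where
  "attach_caret i Leaf = Caret Leaf Leaf"
| "attach_caret i (Caret l r) =
    (if i < num_leaves l then Caret (attach_caret i l) r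
     else Caret l (attach_caret (i - num_leaves l) r))"

text \<open>A tree pair \<open>(T\<^sub>+, T\<^sub>-)\<close>, listed in this order.\<close>
definition tree_pairs :: "(btree \<times> btree) set" where
  "tree_pairs = {(A, B). num_leaves A = num_leaves B}"

definition insertion :: "((btree \<times> btree) \<times> (btree \<times> btree)) set" where
  "insertion = {((A, B), (attach_caret i A, attach_caret i B)) | A B i.
     (A, B) \<in> tree_pairs \<and> i < num_leaves A}"

definition reduced :: "btree \<times> btree \<Rightarrow> bool" where
  "reduced x \<longleftrightarrow> x \<in> tree_pairs \<and> \<not> (\<exists>y. (y, x) \<in> insertion)"

definition pair_equiv :: "((btree \<times> btree) \<times> (btree \<times> btree)) set" where
  "pair_equiv = (insertion \<union> insertion\<inverse>)\<^sup>*"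

text \<open>
  Elements of \<open>F\<close> are equivalence classes of tree pairs. Since a class is a set of pairs,
  the relational composition \<open>g O h\<close> consists of all \<open>(A, C)\<close> with \<open>(A, B) \<in> g\<close> and
  \<open>(B, C) \<in> h\<close> for some \<open>B\<close>. These pairs all lie in one class, but \<open>g O h\<close> need not be the
  whole of it, hence the image under the equivalence.
\<close>
definition thompson_F :: "(btree \<times> btree) set monoid" where
  "thompson_F =
    \<lparr> carrier = tree_pairs // pair_equiv,
      mult = (\<lambda>g h. pair_equiv `` (g O h)),
      one = pair_equiv `` {(Leaf, Leaf)} \<rparr>"

definition reduced_pair :: "(btree \<times> btree) set \<Rightarrow> btree \<times> btree" where
  "reduced_pair g = (THE x. x \<in> g \<and> reduced x)"


section \<open>The \<open>p\<close>-colorable subgroup\<close>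

text \<open>The ring \<open>\<int>[1/2]\<close>, and reduction modulo \<open>p\<close> as congruence modulo its ideal generated by \<open>p\<close>.\<close>
definition dyadic_rats :: "rat set" where
  "dyadic_rats = {of_int a / 2 ^ k | (a :: int) (k :: nat). True}"

definition dyadic_cong :: "nat \<Rightarrow> rat \<Rightarrow> rat \<Rightarrow> bool" where
  "dyadic_cong p x y \<longleftrightarrow> (\<exists>z \<in> dyadic_rats. x - y = of_nat p * z)"

definition rho :: "word \<Rightarrow> rat" where
  "rho w = (\<Sum>i<length w. of_bool (w ! i) / 2 ^ Suc i)"

definition colorable_subgroup :: "nat \<Rightarrow> (btree \<times> btree) set set" where
  "colorable_subgroup p =
    {g \<in> carrier thompson_F. \<exists>(A, B) \<in> g.
       \<forall>i < num_leaves A. dyadic_cong p (rho (leaves A ! i)) (rho (leaves B ! i))}"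


section \<open>Link diagrams and Dehn colorings\<close>

text \<open>
  A connected plane link diagram, encoded by its rotation system. A dart is a half-edge at a
  crossing; \<open>edges\<close> partitions the darts into two-element sets; \<open>rot\<close> sends a dart to the next
  one counterclockwise around its crossing, so that its orbits on the darts are the crossings
  and have four elements; \<open>over\<close> contains the two (opposite) darts of the over-strand at each
  crossing. Each crossing has four corners: the corner of \<open>d\<close> is the one between \<open>d\<close> and
  \<open>rot d\<close>, which is on the left-hand side when leaving the crossing along \<open>d\<close>. The unbounded
  region is the one containing the corner of \<open>outer\<close>.
\<close>
record 'd link_diagram =
  darts :: "'d set"
  edges :: "'d set set"
  rot :: "'d \<Rightarrow> 'd"
  over :: "'d set"
  outer :: 'd

text \<open>
  Following the edge \<open>{d, rot e}\<close> from \<open>d\<close>, the corner on its left is that of \<open>d\<close> at the start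
  and that of \<open>e\<close> at the end. As the diagram is connected, the regions of the plane are the
  classes of corners under the equivalence generated by these identifications.
\<close>
definition same_region :: "'d link_diagram \<Rightarrow> ('d \<times> 'd) set" where
  "same_region D = (let R = {(d, e). {d, rot D e} \<in> edges D} in (R \<union> R\<inverse>)\<^sup>*)"

definition regions :: "'d link_diagram \<Rightarrow> 'd set set" where
  "regions D = darts D // same_region D"

text \<open>The region on the left when leaving the crossing along \<open>d\<close>.\<close>
definition region :: "'d link_diagram \<Rightarrow> 'd \<Rightarrow> 'd set" where
  "region D d = same_region D `` {d}"

text \<open>
  Colors in \<open>\<int>/p\<int>\<close> are represented by integers modulo \<open>p\<close>. At a crossing with over-darts
  \<open>d\<close> and \<open>rot (rot d)\<close>, the under-strand separates the corners of \<open>d\<close> and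
  \<open>rot (rot (rot d))\<close>, which are adjacent along \<open>d\<close>, from the other two.
\<close>
definition dehn_coloring :: "nat \<Rightarrow> 'd link_diagram \<Rightarrow> ('d set \<Rightarrow> int) \<Rightarrow> bool" where
  "dehn_coloring p D c \<longleftrightarrow>
    [c (region D (outer D)) = 0] (mod int p) \<and>
    (\<forall>d \<in> darts D \<inter> over D.
       [c (region D d) + c (region D (rot D (rot D (rot D d))))
        = c (region D (rot D d)) + c (region D (rot D (rot D d)))] (mod int p))"

text \<open>
  \<open>W\<close> is the set of white regions of a checkerboard coloring with white unbounded region.
  The regions on the two sides of an edge \<open>{d, e}\<close> are those to the left of \<open>d\<close> and of \<open>e\<close>.
  By connectedness there is at most one such \<open>W\<close>.
\<close>
definition checkerboard :: "'d link_diagram \<Rightarrow> 'd set set \<Rightarrow> bool" where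
  "checkerboard D W \<longleftrightarrow>
    W \<subseteq> regions D \<and> region D (outer D) \<in> W \<and>
    (\<forall>d e. {d, e} \<in> edges D \<longrightarrow> (region D d \<in> W \<longleftrightarrow> region D e \<notin> W))"

definition trivial_coloring ::
    "nat \<Rightarrow> 'd link_diagram \<Rightarrow> 'd set set \<Rightarrow> ('d set \<Rightarrow> int) \<Rightarrow> bool" where
  "trivial_coloring p D W c \<longleftrightarrow>
    (\<forall>r \<in> W. [c r = 0] (mod int p)) \<and>
    (\<exists>a. \<forall>r \<in> regions D - W. [c r = a] (mod int p))"

definition dehn_colorable :: "nat \<Rightarrow> 'd link_diagram \<Rightarrow> bool" where
  "dehn_colorable p D \<longleftrightarrow>
    (\<exists>W c. checkerboard D W \<and> dehn_coloring p D c \<and> \<not> trivial_coloring p D W c)"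


section \<open>Jones' construction\<close>

text \<open>\<open>Upper\<close> marks \<open>T\<^sub>+\<close> and \<open>Lower\<close> marks \<open>T\<^sub>-\<close>.\<close>
datatype half = Upper | Lower

datatype port = Parent | LeftChild | Middle | RightChild

text \<open>
  The dart \<open>(s, w, q)\<close> sits at the root \<open>w\<close> of a caret. At the root of a tree, \<open>Parent\<close> is the
  dart of the edge in the unbounded region.
\<close>
type_synonym jdart = "half \<times> word \<times> port"

text \<open>
  Counterclockwise order. In the upper tree \<open>Parent\<close> points up and the children point down;
  the lower tree is upside down, with \<open>Parent\<close> pointing down and the children pointing up,
  but left and right are not exchanged.
\<close>
fun jones_rot :: "jdart \<Rightarrow> jdart" where
  "jones_rot (Upper, w, Parent) = (Upper, w, LeftChild)"
| "jones_rot (Upper, w, LeftChild) = (Upper, w, Middle)"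
| "jones_rot (Upper, w, Middle) = (Upper, w, RightChild)"
| "jones_rot (Upper, w, RightChild) = (Upper, w, Parent)"
| "jones_rot (Lower, w, Parent) = (Lower, w, RightChild)"
| "jones_rot (Lower, w, RightChild) = (Lower, w, Middle)"
| "jones_rot (Lower, w, Middle) = (Lower, w, LeftChild)"
| "jones_rot (Lower, w, LeftChild) = (Lower, w, Parent)"

text \<open>The dart at the parent of the non-root vertex \<open>v\<close> that leads to \<open>v\<close>.\<close>
definition child_dart :: "half \<Rightarrow> word \<Rightarrow> jdart" where
  "child_dart s v = (s, butlast v, if last v then RightChild else LeftChild)"

text \<open>The lowest common ancestor of the leaves \<open>i\<close> and \<open>i + 1\<close>.\<close>
definition gap_caret :: "btree \<Rightarrow> nat \<Rightarrow> word" where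
  "gap_caret T i = longest_common_prefix (leaves T ! i) (leaves T ! Suc i)"

text \<open>
  In order: edges between internal vertices of the same tree, edges through glued leaves,
  middle edges, and the edge in the unbounded region. The last one leaves the root of \<open>A\<close>
  upward and passes around the right side, so the unbounded region is on its left.
  Both \<open>A\<close> and \<open>B\<close> are assumed to have at least one caret.
\<close>
definition jones_diagram :: "btree \<times> btree \<Rightarrow> jdart link_diagram" where
  "jones_diagram = (\<lambda>(A, B).
    \<lparr> darts = {Upper} \<times> carets A \<times> UNIV \<union> {Lower} \<times> carets B \<times> UNIV,
      edges =
        {{child_dart Upper v, (Upper, v, Parent)} | v. v \<in> carets A - {[]}} \<union>
        {{child_dart Lower v, (Lower, v, Parent)} | v. v \<in> carets B - {[]}} \<union>
        {{child_dart Upper (leaves A ! i), child_dart Lower (leaves B ! i)} | i.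
           i < num_leaves A} \<union>
        {{(Upper, gap_caret A i, Middle), (Lower, gap_caret B i, Middle)} | i.
           Suc i < num_leaves A} \<union>
        {{(Upper, [], Parent), (Lower, [], Parent)}},
      rot = jones_rot,
      over = {(s, w, q). q \<in> {LeftChild, RightChild}},
      outer = (Upper, [], Parent) \<rparr>)"

text \<open>The diagram of \<open>\<L>(g)\<close>, for \<open>g\<close> not the identity of \<open>F\<close>.\<close>
definition jones_link :: "(btree \<times> btree) set \<Rightarrow> jdart link_diagram" where
  "jones_link g = jones_diagram (reduced_pair g)"

end

theory Submission
  imports Defs
begin

text \<open>
  Read a word \<open>w\<close> as the dyadic interval from \<open>rho w\<close> to \<open>rho w + 1 / 2 ^ length w\<close>: the leaves of a tree
  cut \<open>[0,1]\<close> into consecutive intervals, and the two children of a caret halve the interval of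
  its root. The leaves also cut up the diagram: every white region lies immediately to the left of
  one leaf and every black region immediately to the right of one leaf. Color a white region with
  the left end point of its leaf modulo \<open>p\<close>, and a black region with minus the right end point of
  its leaf. At a caret with interval \<open>[a,b]\<close> and midpoint \<open>m\<close> the four corners then have the colors
  \<open>a\<close>, \<open>-m\<close>, \<open>m\<close>, \<open>-b\<close>, and the Dehn condition \<open>a - m = m - b\<close> says that \<open>m\<close> is the midpoint
  (lemma \<open>midpoint\<close>). The proof colors the corners by these formulas and checks that on
  each side of an edge the corners at its two ends agree (lemma \<open>jones_edge_color\<close>), so that the
  colors descend to regions (lemma \<open>dehn_colorable_by_corners\<close>).

  The upper and the lower tree must agree on the colors of the regions that they share. For left
  end points of leaves this is the defining congruence of the \<open>p\<close>-colorable subgroup; a right end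
  point is the left end point of the next leaf or the point 1. The coloring is not trivial, since
  the white region below the upper root has color \<open>1/2\<close>, which is not 0 modulo \<open>p\<close>.

  It remains to see that the reduced pair of \<open>g\<close> satisfies the congruences if some pair in \<open>g\<close>
  does. Reductions satisfy the diamond property, so the reduced pair exists uniquely and arises
  from any pair in \<open>g\<close> by reductions alone; and a reduction replaces the leaves \<open>w0\<close>, \<open>w1\<close> by
  \<open>w\<close>, which has the same left end point as \<open>w0\<close>.
\<close>

section \<open>Reduced tree pairs\<close>

lemma leaves_neq_Nil [simp]: "leaves T \<noteq> []"
  by (induction T) auto

lemma num_leaves_pos: "num_leaves T > 0"
  by simp

lemma num_leaves_attach_caret [simp]: "num_leaves (attach_caret i T) = Suc (num_leaves T)"
  by (induction T arbitrary: i) auto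

lemma attach_caret_neq_Leaf [simp]: "attach_caret i T \<noteq> Leaf" "Leaf \<noteq> attach_caret i T"
  by (cases T; simp)+

lemma attach_caret_inject:
  assumes "attach_caret i X = attach_caret i Y" "i < num_leaves X" "i < num_leaves Y"
  shows "X = Y"
  using assms
proof (induction X arbitrary: i Y)
  case Leaf
  then show ?case by (cases Y) (auto split: if_splits)
next
  case (Caret l r)
  show ?case
  proof (cases Y)
    case Leaf
    then show ?thesis using Caret.prems by (auto split: if_splits)
  next
    case Y: (Caret l' r')
    have lr: "(if i < num_leaves l then attach_caret i l else l) =
              (if i < num_leaves l' then attach_caret i l' else l')"
      "(if i < num_leaves l then r else attach_caret (i - num_leaves l) r) =
       (if i < num_leaves l' then r' else attach_caret (i - num_leaves l') r')"
      using Caret.prems(1) Y by (auto split: if_splits)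
    have "num_leaves l = num_leaves l'"
      using arg_cong[OF lr(1), of num_leaves] by (auto split: if_splits)
    then show ?thesis
      using Caret.prems lr Y Caret.IH(1)[of i l'] Caret.IH(2)[of "i - num_leaves l" r']
      by (auto split: if_splits)
  qed
qed

text \<open>
  Two different carets of a tree that both end in leaves are disjoint, so both can be removed:
  \<open>Z\<close> is the tree without either. Attaching the left caret shifts the position of the right one,
  which explains the index \<open>j - 1\<close>.
\<close>
lemma attach_caret_diamond:
  assumes "attach_caret i X = attach_caret j Y" "i < j" "i < num_leaves X" "j < num_leaves Y"
  shows "\<exists>Z. X = attach_caret (j - 1) Z \<and> Y = attach_caret i Z \<and> j - 1 < num_leaves Z"
  using assms
proof (induction X arbitrary: i j Y)
  case Leaf
  then show ?case by (cases Y) (auto split: if_splits)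
next
  case (Caret l r)
  obtain l' r' where Y: "Y = Caret l' r'"
    using Caret.prems by (cases Y) auto
  consider "i < num_leaves l" "j < num_leaves l'" | "i < num_leaves l" "j \<ge> num_leaves l'"
    | "i \<ge> num_leaves l" "j < num_leaves l'" | "i \<ge> num_leaves l" "j \<ge> num_leaves l'"
    by linarith
  then show ?case
  proof cases
    case 1
    then obtain Z where "l = attach_caret (j - 1) Z" "l' = attach_caret i Z" "j - 1 < num_leaves Z"
      using Caret.IH(1)[of i j l'] Caret.prems Y by auto
    then show ?thesis
      using 1 Caret.prems Y by (intro exI[of _ "Caret Z r"]) auto
  next
    case 2
    then have "l' = attach_caret i l" "r = attach_caret (j - num_leaves l') r'"
      using Caret.prems Y by auto
    then show ?thesis
      using 2 Caret.prems Y by (intro exI[of _ "Caret l r'"]) auto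
  next
    case 3
    then have "l = attach_caret j l'"
      using Caret.prems Y by auto
    then show ?thesis
      using 3 Caret.prems by auto
  next
    case 4
    then have l: "l' = l"
      using Caret.prems Y by auto
    have r: "attach_caret (i - num_leaves l) r = attach_caret (j - num_leaves l) r'"
      using Caret.prems Y 4 by auto
    have bounds: "i - num_leaves l < j - num_leaves l" "i - num_leaves l < num_leaves r"
        "j - num_leaves l < num_leaves r'"
      using 4 Caret.prems Y l by auto
    obtain Z where "r = attach_caret (j - num_leaves l - 1) Z"
        "r' = attach_caret (i - num_leaves l) Z" "j - num_leaves l - 1 < num_leaves Z"
      using Caret.IH(2)[OF r bounds] by blast
    then show ?thesis
      using 4 Caret.prems Y l by (intro exI[of _ "Caret l Z"]) auto
  qed
qed

lemma insertion_tree_pairs: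
  assumes "(x, y) \<in> insertion"
  shows "x \<in> tree_pairs" "y \<in> tree_pairs"
  using assms unfolding insertion_def by (auto simp: tree_pairs_def)

lemma insertion_diamond:
  assumes "(x, z) \<in> insertion" "(y, z) \<in> insertion" "x \<noteq> y"
  shows "\<exists>u. (u, x) \<in> insertion \<and> (u, y) \<in> insertion"
proof -
  obtain A B i where x: "x = (A, B)" "z = (attach_caret i A, attach_caret i B)"
      "num_leaves A = num_leaves B" "i < num_leaves A"
    using assms(1) by (auto simp: insertion_def tree_pairs_def)
  obtain C D j where y: "y = (C, D)" "z = (attach_caret j C, attach_caret j D)"
      "num_leaves C = num_leaves D" "j < num_leaves C"
    using assms(2) by (auto simp: insertion_def tree_pairs_def)
  have common: "\<exists>u. (u, (A, B)) \<in> insertion \<and> (u, (C, D)) \<in> insertion"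
    if eq: "attach_caret i A = attach_caret j C" "attach_caret i B = attach_caret j D"
      and bounds: "i < j" "num_leaves A = num_leaves B" "i < num_leaves A"
        "num_leaves C = num_leaves D" "j < num_leaves C"
    for A B C D i j
  proof -
    obtain Z where Z: "A = attach_caret (j - 1) Z" "C = attach_caret i Z" "j - 1 < num_leaves Z"
      using attach_caret_diamond[OF eq(1) bounds(1,3,5)] by blast
    obtain Z' where Z': "B = attach_caret (j - 1) Z'" "D = attach_caret i Z'"
      using attach_caret_diamond[OF eq(2) bounds(1)] bounds(2-5) by metis
    have "(Z, Z') \<in> tree_pairs" "i < num_leaves Z"
      using bounds Z Z' by (auto simp: tree_pairs_def)
    then show ?thesis
      using Z Z' unfolding insertion_def by (intro exI[of _ "(Z, Z')"]) blast
  qed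
  have eq: "attach_caret i A = attach_caret j C" "attach_caret i B = attach_caret j D"
    using x y by auto
  consider "i < j" | "j < i" | "i = j" by linarith
  then show ?thesis
  proof cases
    case 1
    then show ?thesis using common[OF eq 1] x y by auto
  next
    case 2
    then show ?thesis using common[OF eq[symmetric] 2] x y by auto
  next
    case 3
    then show ?thesis
      using assms(3) x y eq attach_caret_inject[of i A C] attach_caret_inject[of i B D] by auto
  qed
qed

text \<open>
  If \<open>x\<close> is reachable from \<open>y\<close> by reductions, it remains reachable after any other first reduction:
  the diamond is pushed along the path, and cannot get stuck because \<open>x\<close> has no reduction.
\<close>
lemma reduced_insertion_star_back:
  assumes "(x, y) \<in> insertion\<^sup>*" "reduced x" "(z, y) \<in> insertion"
  shows "(x, z) \<in> insertion\<^sup>*"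
  using assms(1,3)
proof (induction arbitrary: z rule: rtrancl_induct)
  case base
  then show ?case using assms(2) unfolding reduced_def by blast
next
  case (step y y')
  show ?case
  proof (cases "z = y")
    case True
    then show ?thesis using step by simp
  next
    case False
    then obtain u where "(u, y) \<in> insertion" "(u, z) \<in> insertion"
      using insertion_diamond step by blast
    then show ?thesis using step.IH by (meson rtrancl.rtrancl_into_rtrancl)
  qed
qed

lemma reduced_equiv_imp_insertion_star:
  assumes "(x, y) \<in> pair_equiv" "reduced x"
  shows "(x, y) \<in> insertion\<^sup>*"
  using assms(1) unfolding pair_equiv_def
proof (induction rule: rtrancl_induct)
  case (step y z)
  then show ?case
    using reduced_insertion_star_back[OF _ assms(2)]
    by (meson Un_iff converse_iff rtrancl.rtrancl_into_rtrancl)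
qed simp

lemma equiv_pair_equiv: "equiv UNIV pair_equiv"
  unfolding pair_equiv_def
  by (intro equivI refl_rtrancl sym_rtrancl trans_rtrancl) (auto simp: sym_Un_converse)

lemma pair_equiv_tree_pairs:
  assumes "(x, y) \<in> pair_equiv" "x \<in> tree_pairs"
  shows "y \<in> tree_pairs"
  using assms unfolding pair_equiv_def
  by (induction rule: rtrancl_induct) (auto dest: insertion_tree_pairs)

lemma wf_insertion: "wf insertion"
  by (rule wf_subset[OF wf_measure[of "\<lambda>(A, B). num_leaves A"]]) (auto simp: insertion_def)

lemma reduced_pair_insertion_star:
  assumes "g \<in> carrier thompson_F" "x \<in> g"
  shows "reduced_pair g \<in> g" "reduced (reduced_pair g)" "(reduced_pair g, x) \<in> insertion\<^sup>*"
proof -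
  obtain t where t: "t \<in> tree_pairs" "g = pair_equiv `` {t}"
    using assms(1) by (auto simp: thompson_F_def elim: quotientE)
  have in_equiv: "(y, z) \<in> pair_equiv" if "y \<in> g" "z \<in> g" for y z
    using that t(2) equiv_pair_equiv by (meson Image_singleton_iff equivE symE transE)
  obtain y where y: "y \<in> g" "\<And>z. (z, y) \<in> insertion \<Longrightarrow> z \<notin> g"
    using wfE_min[OF wf_insertion assms(2)] by metis
  have "reduced y"
    unfolding reduced_def
  proof (intro conjI notI)
    show "y \<in> tree_pairs" using y(1) t pair_equiv_tree_pairs by auto
    assume "\<exists>z. (z, y) \<in> insertion"
    then obtain z where z: "(z, y) \<in> insertion" by blast
    then have "(t, z) \<in> pair_equiv"
      using y(1) t(2) unfolding pair_equiv_def by (auto intro: rtrancl_into_rtrancl)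
    then show False using y(2)[OF z] t(2) by simp
  qed
  have unique: "z = y" if "z \<in> g \<and> reduced z" for z
  proof -
    have "(z, y) \<in> insertion\<^sup>*"
      using reduced_equiv_imp_insertion_star[OF in_equiv] that y(1) by blast
    then show ?thesis using \<open>reduced y\<close> by (auto simp: reduced_def elim: rtranclE)
  qed
  have eq: "reduced_pair g = y"
    unfolding reduced_pair_def
  proof (rule the_equality)
    show "y \<in> g \<and> reduced y" using y(1) \<open>reduced y\<close> by (rule conjI)
  qed (rule unique)
  show "reduced_pair g \<in> g" "reduced (reduced_pair g)"
    using eq y(1) \<open>reduced y\<close> by auto
  show "(reduced_pair g, x) \<in> insertion\<^sup>*"
    using reduced_equiv_imp_insertion_star[OF in_equiv[OF y(1) assms(2)] \<open>reduced y\<close>] eq by simp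
qed

lemma num_leaves_eq_1_iff: "num_leaves T = Suc 0 \<longleftrightarrow> T = Leaf"
proof (cases T)
  case (Caret l r)
  then show ?thesis using num_leaves_pos[of l] num_leaves_pos[of r]
    by (simp del: length_greater_0_conv)
qed simp

lemma reduced_pair_nontrivial:
  assumes "g \<in> carrier thompson_F" "g \<noteq> \<one>\<^bsub>thompson_F\<^esub>" "reduced_pair g = (A, B)"
  shows "num_leaves A = num_leaves B" "A \<noteq> Leaf" "B \<noteq> Leaf"
proof -
  obtain t where t: "t \<in> tree_pairs" "g = pair_equiv `` {t}"
    using assms(1) by (auto simp: thompson_F_def elim: quotientE)
  then have "t \<in> g" by (simp add: pair_equiv_def)
  note red = reduced_pair_insertion_star[OF assms(1) this]
  show num: "num_leaves A = num_leaves B"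
    using red(2) assms(3) by (auto simp: reduced_def tree_pairs_def)
  have "(A, B) \<noteq> (Leaf, Leaf)"
  proof
    assume "(A, B) = (Leaf, Leaf)"
    then have "(t, (Leaf, Leaf)) \<in> pair_equiv"
      using red(1) t assms(3) by auto
    then have "g = \<one>\<^bsub>thompson_F\<^esub>"
      using t(2) equiv_class_eq[OF equiv_pair_equiv] by (simp add: thompson_F_def)
    then show False using assms(2) by simp
  qed
  then show "A \<noteq> Leaf" "B \<noteq> Leaf"
    using num num_leaves_eq_1_iff[of A] num_leaves_eq_1_iff[of B] by auto
qed


section \<open>Positions modulo \<open>p\<close>\<close>

lemma dyadic_ratsI: "x = of_int a / 2 ^ k \<Longrightarrow> x \<in> dyadic_rats"
  unfolding dyadic_rats_def by blast

lemma dyadic_rats_add: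
  assumes "x \<in> dyadic_rats" "y \<in> dyadic_rats"
  shows "x + y \<in> dyadic_rats"
proof -
  obtain a k b l where x: "x = of_int a / 2 ^ k" and y: "y = of_int b / 2 ^ l"
    using assms by (auto simp: dyadic_rats_def)
  have "x + y = of_int (a * 2 ^ l + b * 2 ^ k) / 2 ^ (k + l)"
    unfolding x y by (simp add: add_frac_eq power_add)
  then show ?thesis by (rule dyadic_ratsI)
qed

lemma dyadic_rats_uminus:
  assumes "x \<in> dyadic_rats"
  shows "- x \<in> dyadic_rats"
proof -
  obtain a k where "x = of_int a / 2 ^ k"
    using assms by (auto simp: dyadic_rats_def)
  then show ?thesis by (intro dyadic_ratsI[of _ "- a" k]) simp
qed

lemma dyadic_rats_half:
  assumes "x \<in> dyadic_rats"
  shows "x / 2 \<in> dyadic_rats"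
proof -
  obtain a k where "x = of_int a / 2 ^ k"
    using assms by (auto simp: dyadic_rats_def)
  then show ?thesis by (intro dyadic_ratsI[of _ a "Suc k"]) simp
qed

lemma of_int_dyadic_rats: "of_int n \<in> dyadic_rats"
  by (rule dyadic_ratsI[of _ n 0]) simp

lemma dyadic_cong_sym:
  assumes "dyadic_cong p x y"
  shows "dyadic_cong p y x"
proof -
  obtain u where "u \<in> dyadic_rats" "x - y = of_nat p * u"
    using assms by (auto simp: dyadic_cong_def)
  then have "- u \<in> dyadic_rats" "y - x = of_nat p * (- u)"
    using dyadic_rats_uminus by (auto simp: algebra_simps)
  then show ?thesis unfolding dyadic_cong_def by blast
qed

lemma dyadic_cong_trans:
  assumes "dyadic_cong p x y" "dyadic_cong p y z"
  shows "dyadic_cong p x z"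
proof -
  obtain u where u: "u \<in> dyadic_rats" "x - y = of_nat p * u"
    using assms(1) by (auto simp: dyadic_cong_def)
  obtain v where v: "v \<in> dyadic_rats" "y - z = of_nat p * v"
    using assms(2) by (auto simp: dyadic_cong_def)
  have "x - z = (x - y) + (y - z)" by simp
  also have "\<dots> = of_nat p * (u + v)" unfolding u(2) v(2) by (rule distrib_left[symmetric])
  finally show ?thesis
    unfolding dyadic_cong_def using dyadic_rats_add[OF u(1) v(1)] by blast
qed

lemma dyadic_cong_of_int:
  assumes "dyadic_cong p (of_int a) (of_int b)" "odd p"
  shows "[a = b] (mod int p)"
proof -
  obtain c k where "of_int a - of_int b = (of_nat p :: rat) * (of_int c / 2 ^ k)"
    using assms(1) by (auto simp: dyadic_cong_def dyadic_rats_def)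
  then have "(of_int ((a - b) * 2 ^ k) :: rat) = of_int (int p * c)"
    by (simp add: field_simps)
  then have "(a - b) * 2 ^ k = int p * c"
    using of_int_eq_iff by blast
  then have "int p dvd (a - b) * 2 ^ k"
    by simp
  moreover have "coprime (int p) (2 ^ k)"
    using assms(2) by simp
  ultimately have "int p dvd a - b"
    using coprime_dvd_mult_left_iff by blast
  then show ?thesis by (simp add: cong_iff_dvd_diff)
qed

text \<open>
  With \<open>h\<close> an inverse of 2 modulo \<open>p\<close>, the following are the end points of the dyadic interval of
  a word, written with \<open>h\<close> instead of \<open>1/2\<close> so that they are integers.
\<close>
fun left_end :: "int \<Rightarrow> word \<Rightarrow> int" where
  "left_end h [] = 0"
| "left_end h (a # w) = h * (of_bool a + left_end h w)"

definition right_end :: "int \<Rightarrow> word \<Rightarrow> int" where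
  "right_end h w = left_end h w + h ^ length w"

lemma left_end_append: "left_end h (u @ v) = left_end h u + h ^ length u * left_end h v"
  by (induction u) (auto simp: algebra_simps)

lemma left_end_replicate_False [simp]: "left_end h (replicate k False) = 0"
  by (induction k) auto

lemma rho_Cons: "rho (a # w) = (of_bool a + rho w) / 2"
proof -
  have "rho (a # w) = of_bool a / 2 + (\<Sum>i<length w. of_bool (w ! i) / 2 ^ Suc (Suc i))"
    unfolding rho_def by (simp add: sum.lessThan_Suc_shift del: sum.lessThan_Suc)
  also have "(\<Sum>i<length w. of_bool (w ! i) / 2 ^ Suc (Suc i)) = rho w / 2"
    unfolding rho_def by (simp add: sum_divide_distrib)
  finally show ?thesis by (simp add: add_divide_distrib)
qed

lemma rho_snoc_False: "rho (w @ [False]) = rho w"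
proof (induction w)
  case Nil
  then show ?case by (simp add: rho_def)
qed (simp add: rho_Cons)

context
  fixes p :: nat and h :: int
  assumes h: "2 * h = int p + 1"
begin

lemma odd_modulus: "odd p"
proof
  assume "even p"
  then have "even (2 * h - int p)" by simp
  then show False using h by simp
qed

text \<open>So congruences between values of \<open>rho\<close> can be read off from the integers \<open>left_end\<close>.\<close>
lemma dyadic_cong_left_end: "dyadic_cong p (of_int (left_end h w)) (rho w)"
proof (induction w)
  case Nil
  show ?case
    unfolding dyadic_cong_def dyadic_rats_def by (auto simp: rho_def intro!: exI[of _ 0])
next
  case (Cons a w)
  then obtain z where z: "z \<in> dyadic_rats" "of_int (left_end h w) - rho w = of_nat p * z"
    by (auto simp: dyadic_cong_def)
  let ?b = "of_bool a + left_end h w"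
  have half: "of_int h = (of_nat p + 1) / (2 :: rat)"
    using arg_cong[OF h, of "of_int :: int \<Rightarrow> rat"] by simp
  have "rho w = of_int (left_end h w) - of_nat p * z" using z(2) by simp
  then have "of_int (left_end h (a # w)) - rho (a # w) = of_nat p * (of_int ?b / 2 + z / 2)"
    by (simp add: rho_Cons half field_simps)
  moreover have "of_int ?b / 2 + z / 2 \<in> dyadic_rats"
    by (intro dyadic_rats_add dyadic_rats_half of_int_dyadic_rats z(1))
  ultimately show ?case unfolding dyadic_cong_def by blast
qed

lemma cong_left_end:
  assumes "dyadic_cong p (rho v) (rho w)"
  shows "[left_end h v = left_end h w] (mod int p)"
proof (rule dyadic_cong_of_int[OF _ odd_modulus])
  show "dyadic_cong p (of_int (left_end h v)) (of_int (left_end h w))"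
    using dyadic_cong_trans[OF dyadic_cong_trans[OF dyadic_cong_left_end assms]
        dyadic_cong_sym[OF dyadic_cong_left_end]] .
qed

lemma double_power: "[2 * h ^ Suc n = h ^ n] (mod int p)"
proof -
  have "2 * h ^ Suc n - h ^ n = int p * h ^ n"
    using h by (simp add: algebra_simps flip: mult.assoc)
  then show ?thesis by (simp add: cong_iff_dvd_diff)
qed

text \<open>The midpoint of the interval of \<open>w\<close> is the left end point of its right half.\<close>
lemma midpoint: "[2 * left_end h (w @ [True]) = left_end h w + right_end h w] (mod int p)"
  using cong_add_lcancel[THEN iffD2, OF double_power[of "length w"], of "2 * left_end h w"]
  by (simp add: left_end_append right_end_def algebra_simps)

lemma right_end_snoc:
  "right_end h (w @ [False]) = left_end h (w @ [True])"
  "[right_end h (w @ [True]) = right_end h w] (mod int p)"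
  using cong_add_lcancel[THEN iffD2, OF double_power[of "length w"], of "left_end h w"]
  by (simp_all add: left_end_append right_end_def algebra_simps)

lemma right_end_append_True: "[right_end h (w @ replicate k True) = right_end h w] (mod int p)"
proof (induction k)
  case (Suc k)
  have "w @ replicate (Suc k) True = (w @ replicate k True) @ [True]"
    by (simp add: replicate_append_same)
  then show ?case using Suc right_end_snoc(2) by (metis cong_trans)
qed simp

end


section \<open>Consecutive leaves\<close>

lemma leaves_0: "\<exists>k. leaves T ! 0 = replicate k False"
proof (induction T)
  case (Caret l r)
  then obtain k where "leaves l ! 0 = replicate k False" by blast
  then show ?case by (intro exI[of _ "Suc k"]) (simp add: nth_append)
qed simp

lemma leaves_last: "\<exists>k. leaves T ! (num_leaves T - 1) = replicate k True"
proof (induction T)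
  case (Caret l r)
  then obtain k where "leaves r ! (num_leaves r - 1) = replicate k True" by blast
  moreover have "num_leaves (Caret l r) - 1 - num_leaves l = num_leaves r - 1" by simp
  moreover have "\<not> num_leaves (Caret l r) - 1 < num_leaves l"
    using num_leaves_pos[of r] unfolding leaves.simps length_append length_map by linarith
  moreover have "num_leaves (Caret l r) - 1 < num_leaves (Caret l r)"
    using num_leaves_pos by (meson diff_less zero_less_one)
  ultimately show ?case
    by (intro exI[of _ "Suc k"]) (simp add: nth_append)
qed simp

text \<open>
  The left leaf is the last one below the left child of the caret of the gap, and the right leaf is
  the first one below its right child. So both touch the midpoint of the interval of this caret.
\<close>
lemma consecutive_leaves:
  assumes "Suc i < num_leaves T"
  obtains k m where "gap_caret T i \<in> carets T"
    "leaves T ! i = gap_caret T i @ False # replicate k True"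
    "leaves T ! Suc i = gap_caret T i @ True # replicate m False"
proof -
  have "\<exists>u k m. u \<in> carets T \<and> leaves T ! i = u @ False # replicate k True \<and>
          leaves T ! Suc i = u @ True # replicate m False"
    using assms
  proof (induction T arbitrary: i)
    case (Caret l r)
    consider "Suc i < num_leaves l" | "Suc i = num_leaves l" | "num_leaves l \<le> i" by linarith
    then show ?case
    proof cases
      case 1
      then obtain u k m where "u \<in> carets l" "leaves l ! i = u @ False # replicate k True"
          "leaves l ! Suc i = u @ True # replicate m False"
        using Caret.IH(1) by blast
      then show ?thesis
        using 1 by (intro exI[of _ "False # u"] exI[of _ k] exI[of _ m]) (auto simp: nth_append)
    next
      case 2
      obtain k m where "leaves l ! (num_leaves l - 1) = replicate k True"
          "leaves r ! 0 = replicate m False"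
        using leaves_0 leaves_last by blast
      moreover have "num_leaves l - 1 = i" "i < num_leaves l" using 2 by auto
      ultimately show ?thesis
        using 2 by (intro exI[of _ "[]"] exI[of _ k] exI[of _ m]) (auto simp: nth_append)
    next
      case 3
      have "Suc (i - num_leaves l) < num_leaves r" using 3 Caret.prems by auto
      then obtain u k m where "u \<in> carets r"
          "leaves r ! (i - num_leaves l) = u @ False # replicate k True"
          "leaves r ! Suc (i - num_leaves l) = u @ True # replicate m False"
        using Caret.IH(2) by blast
      then show ?thesis
        using 3 Caret.prems
        by (intro exI[of _ "True # u"] exI[of _ k] exI[of _ m]) (auto simp: nth_append Suc_diff_le)
    qed
  qed simp
  moreover have "longest_common_prefix (u @ False # v) (u @ True # w) = u" for u v w
    by (induction u) auto
  ultimately show ?thesis using that by (fastforce simp: gap_caret_def)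
qed

lemma right_end_leaf:
  assumes "2 * h = int p + 1" "Suc i < num_leaves T"
  shows "[right_end h (leaves T ! i) = left_end h (leaves T ! Suc i)] (mod int p)"
    and "left_end h (leaves T ! Suc i) = left_end h (gap_caret T i @ [True])"
proof -
  obtain k m where km: "leaves T ! i = (gap_caret T i @ [False]) @ replicate k True"
    "leaves T ! Suc i = (gap_caret T i @ [True]) @ replicate m False"
    using consecutive_leaves[OF assms(2)] by (metis append_Cons append_Nil append_assoc)
  show eq: "left_end h (leaves T ! Suc i) = left_end h (gap_caret T i @ [True])"
    unfolding km(2) left_end_append[of h "gap_caret T i @ [True]"] by simp
  show "[right_end h (leaves T ! i) = left_end h (leaves T ! Suc i)] (mod int p)"
    unfolding eq unfolding km(1) right_end_snoc(1)[OF assms(1), symmetric]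
    by (rule right_end_append_True[OF assms(1)])
qed

text \<open>A right end point is the next left end point, or 1 for the last leaf.\<close>
lemma cong_right_end_leaves:
  assumes h: "2 * h = int p + 1" and num: "num_leaves A = num_leaves B"
    and left: "\<And>i. i < num_leaves A \<Longrightarrow>
      [left_end h (leaves A ! i) = left_end h (leaves B ! i)] (mod int p)"
    and i: "i < num_leaves A"
  shows "[right_end h (leaves A ! i) = right_end h (leaves B ! i)] (mod int p)"
proof (cases "Suc i < num_leaves A")
  case True
  then show ?thesis
    using right_end_leaf(1)[OF h, of i A] right_end_leaf(1)[OF h, of i B] left[OF True] num
    by (metis cong_sym cong_trans)
next
  case False
  have "[right_end h (leaves T ! (num_leaves T - 1)) = 1] (mod int p)" for T
  proof -
    obtain k where "leaves T ! (num_leaves T - 1) = [] @ replicate k True"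
      using leaves_last by auto
    then show ?thesis
      using right_end_append_True[OF h, of "[]" k] by (simp add: right_end_def)
  qed
  moreover have "i = num_leaves A - 1" "i = num_leaves B - 1" using False i num by auto
  ultimately show ?thesis by (metis cong_sym cong_trans)
qed

lemma butlast_leaf_caret:
  assumes "T \<noteq> Leaf" "v \<in> set (leaves T)"
  shows "v \<noteq> []" "butlast v \<in> carets T"
proof -
  have "v \<noteq> [] \<and> butlast v \<in> carets T"
    using assms
  proof (induction T arbitrary: v)
    case (Caret l r)
    then consider u where "u \<in> set (leaves l)" "v = False # u"
      | u where "u \<in> set (leaves r)" "v = True # u"
      by auto
    then show ?case
    proof cases
      case 1
      then show ?thesis using Caret.IH(1)[of u] by (cases "l = Leaf") auto
    next
      case 2
      then show ?thesis using Caret.IH(2)[of u] by (cases "r = Leaf") auto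
    qed
  qed simp
  then show "v \<noteq> []" "butlast v \<in> carets T" by auto
qed

lemma butlast_caret:
  assumes "v \<in> carets T" "v \<noteq> []"
  shows "butlast v \<in> carets T"
  using assms
proof (induction T arbitrary: v)
  case (Caret l r)
  have "[] \<in> carets T" if "u \<in> carets T" for u T
    using that by (cases T) auto
  then show ?case using Caret by auto
qed simp

lemma leaves_attach_caret:
  assumes "i < num_leaves T"
  shows "leaves (attach_caret i T) =
    take i (leaves T) @ [leaves T ! i @ [False], leaves T ! i @ [True]] @ drop (Suc i) (leaves T)"
  using assms
proof (induction T arbitrary: i)
  case (Caret l r)
  then show ?case
    by (auto simp: nth_append take_map drop_map Suc_diff_le)
qed simp

text \<open>
  A reduction replaces the leaves \<open>w0\<close> and \<open>w1\<close> by \<open>w\<close>, and \<open>rho w0 = rho w\<close>; so the congruence for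
  the new leaf is the one for \<open>w0\<close>.
\<close>
lemma insertion_star_leaves_cong:
  assumes "((A, B), (C, D)) \<in> insertion\<^sup>*"
    and "\<forall>i < num_leaves C. dyadic_cong p (rho (leaves C ! i)) (rho (leaves D ! i))"
  shows "\<forall>i < num_leaves A. dyadic_cong p (rho (leaves A ! i)) (rho (leaves B ! i))"
  using assms
proof (induction rule: converse_rtrancl_induct2)
  case (step A B C D)
  then obtain j where j: "C = attach_caret j A" "D = attach_caret j B"
      "num_leaves A = num_leaves B" "j < num_leaves A"
    by (auto simp: insertion_def tree_pairs_def)
  show ?case
  proof (intro allI impI)
    fix i assume i: "i < num_leaves A"
    let ?i = "if i \<le> j then i else Suc i"
    have "rho (leaves (attach_caret j T) ! ?i) = rho (leaves T ! i)"
      if "j < num_leaves T" "i < num_leaves T" for T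
      using that by (auto simp: leaves_attach_caret nth_append rho_snoc_False min_def nth_Cons'
          dest: not_less_eq_eq[THEN iffD1])
    then show "dyadic_cong p (rho (leaves A ! i)) (rho (leaves B ! i))"
      using step.IH[OF step.prems] i j by (metis (full_types) num_leaves_attach_caret Suc_mono less_SucI)
  qed
qed simp


section \<open>Colorings given by the corners\<close>

text \<open>
  A function on corners that respects the identifications of corners across edges descends to the
  regions, so that a coloring and a checkerboard pattern can be checked at the crossings alone.
\<close>
lemma dehn_colorable_by_corners:
  fixes D :: "'d link_diagram" and col :: "'d \<Rightarrow> int" and white :: "'d \<Rightarrow> bool"
  assumes darts: "\<And>d e. {d, e} \<in> edges D \<Longrightarrow> d \<in> darts D"
    and white_edge: "\<And>d e. {d, e} \<in> edges D \<Longrightarrow> white d \<noteq> white e"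
    and white_rot: "\<And>d. white (rot D d) \<noteq> white d"
    and col_edge: "\<And>d e. {d, rot D e} \<in> edges D \<Longrightarrow> [col d = col e] (mod int p)"
    and outer: "outer D \<in> darts D" "white (outer D)" "[col (outer D) = 0] (mod int p)"
    and crossing: "\<And>d. d \<in> darts D \<Longrightarrow> d \<in> over D \<Longrightarrow>
       [col d + col (rot D (rot D (rot D d))) = col (rot D d) + col (rot D (rot D d))] (mod int p)"
    and nonzero: "d0 \<in> darts D" "white d0" "\<not> [col d0 = 0] (mod int p)"
  shows "dehn_colorable p D"
proof -
  have inv: "white d = white e \<and> [col d = col e] (mod int p)" if "(d, e) \<in> same_region D" for d e
    using that unfolding same_region_def Let_def
  proof (induction rule: rtrancl_induct)
    case (step e f)
    then have "{e, rot D f} \<in> edges D \<or> {f, rot D e} \<in> edges D" by auto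
    then have "white e = white f \<and> [col e = col f] (mod int p)"
      using white_edge white_rot col_edge by (metis cong_sym)
    then show ?case using step.IH by (metis cong_trans)
  qed simp
  have equiv: "equiv UNIV (same_region D)"
    unfolding same_region_def Let_def
    by (intro equivI refl_rtrancl sym_rtrancl trans_rtrancl) (auto simp: sym_Un_converse)
  have self: "d \<in> region D d" for d
    using equiv by (auto simp: region_def equiv_def refl_on_def)
  define c where "c r = col (SOME d. d \<in> r)" for r
  have c: "[c (region D d) = col d] (mod int p)" for d
  proof -
    have "(SOME e. e \<in> region D d) \<in> region D d" using self by (rule someI)
    then show ?thesis using inv by (auto simp: c_def region_def intro: cong_sym)
  qed
  define W where "W = region D ` {d \<in> darts D. white d}"
  have W: "region D d \<in> W \<longleftrightarrow> white d" if "d \<in> darts D" for d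
  proof
    assume "region D d \<in> W"
    then obtain e where e: "white e" "region D d = region D e" by (auto simp: W_def)
    then have "(e, d) \<in> same_region D" using self[of d] by (auto simp: region_def)
    then show "white d" using inv e by blast
  qed (use that in \<open>auto simp: W_def\<close>)
  have "checkerboard D W"
    unfolding checkerboard_def
  proof (intro conjI allI impI)
    show "W \<subseteq> regions D" by (auto simp: W_def regions_def region_def quotientI)
    show "region D (outer D) \<in> W" using W outer by blast
    fix d e assume "{d, e} \<in> edges D"
    then show "region D d \<in> W \<longleftrightarrow> region D e \<notin> W"
      using W darts white_edge by (metis insert_commute)
  qed
  moreover have "dehn_coloring p D c"
    unfolding dehn_coloring_def
  proof (intro conjI ballI)
    show "[c (region D (outer D)) = 0] (mod int p)" using c outer(3) by (rule cong_trans)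
    fix d assume "d \<in> darts D \<inter> over D"
    then have "[col d + col (rot D (rot D (rot D d)))
        = col (rot D d) + col (rot D (rot D d))] (mod int p)"
      using crossing by blast
    then show "[c (region D d) + c (region D (rot D (rot D (rot D d))))
        = c (region D (rot D d)) + c (region D (rot D (rot D d)))] (mod int p)"
      using cong_add[OF c c] by (meson cong_sym cong_trans)
  qed
  moreover have "\<not> trivial_coloring p D W c"
    using c[of d0] W[of d0] nonzero
    by (auto simp: trivial_coloring_def dest!: bspec intro: cong_trans cong_sym)
  ultimately show ?thesis unfolding dehn_colorable_def by blast
qed


section \<open>The coloring of Jones' diagram\<close>

fun corner_white :: "jdart \<Rightarrow> bool" where
  "corner_white (Upper, w, q) \<longleftrightarrow> q \<in> {Parent, Middle}"
| "corner_white (Lower, w, q) \<longleftrightarrow> q \<in> {LeftChild, RightChild}"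

fun corner_color :: "int \<Rightarrow> jdart \<Rightarrow> int" where
  "corner_color h (Upper, w, Parent) = left_end h w"
| "corner_color h (Upper, w, LeftChild) = - left_end h (w @ [True])"
| "corner_color h (Upper, w, Middle) = left_end h (w @ [True])"
| "corner_color h (Upper, w, RightChild) = - right_end h w"
| "corner_color h (Lower, w, Parent) = - right_end h w"
| "corner_color h (Lower, w, RightChild) = left_end h (w @ [True])"
| "corner_color h (Lower, w, Middle) = - left_end h (w @ [True])"
| "corner_color h (Lower, w, LeftChild) = left_end h w"

lemma corner_white_rot: "corner_white (jones_rot d) \<noteq> corner_white d"
  by (cases d rule: jones_rot.cases) auto

lemma corner_color_crossing:
  assumes "2 * h = int p + 1" "d \<in> {(s, w, q). q \<in> {LeftChild, RightChild}}"
  shows "[corner_color h d + corner_color h (jones_rot (jones_rot (jones_rot d))) =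
    corner_color h (jones_rot d) + corner_color h (jones_rot (jones_rot d))] (mod int p)"
proof -
  obtain s w q where "d = (s, w, q)" "q = LeftChild \<or> q = RightChild"
    using assms(2) by auto
  then show ?thesis
    using midpoint[OF assms(1), of w]
    by (cases s) (auto simp: cong_iff_dvd_diff algebra_simps dvd_diff_commute)
qed

text \<open>
  An edge from a caret to its child \<open>v\<close> separates the white region at the left end point of \<open>v\<close>
  from the black one at its right end point. When one leaves the caret, the black region is on the
  left-hand side in the upper tree, and the white one in the lower tree, which is upside down.
\<close>
lemma corner_color_child_dart:
  assumes "2 * h = int p + 1" "v \<noteq> []"
  shows "[corner_color h (child_dart Upper v) = - right_end h v] (mod int p)"
    and "corner_color h (child_dart Lower v) = left_end h v"
proof -
  obtain u b where "v = u @ [b]" using assms(2) by (metis rev_exhaust)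
  then show "[corner_color h (child_dart Upper v) = - right_end h v] (mod int p)"
    "corner_color h (child_dart Lower v) = left_end h v"
    using right_end_snoc[OF assms(1), of u]
    by (cases b; auto simp: child_dart_def cong_minus_minus_iff left_end_append intro: cong_sym)+
qed

text \<open>The same edge, seen from its other side: the corner that precedes the child dart.\<close>
lemma corner_color_rot_child_dart:
  assumes "2 * h = int p + 1" "v \<noteq> []"
  shows "jones_rot e = child_dart Upper v \<Longrightarrow> corner_color h e = left_end h v"
    and "jones_rot e = child_dart Lower v \<Longrightarrow> [corner_color h e = - right_end h v] (mod int p)"
proof -
  obtain u b where "v = u @ [b]" using assms(2) by (metis rev_exhaust)
  then show "jones_rot e = child_dart Upper v \<Longrightarrow> corner_color h e = left_end h v"
    "jones_rot e = child_dart Lower v \<Longrightarrow> [corner_color h e = - right_end h v] (mod int p)"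
    using right_end_snoc[OF assms(1), of u]
    by (cases b; cases e rule: jones_rot.cases;
        auto simp: child_dart_def cong_minus_minus_iff left_end_append intro: cong_sym)+
qed

lemma jones_rot_eq_iff:
  "jones_rot e = (Upper, w, Parent) \<longleftrightarrow> e = (Upper, w, RightChild)"
  "jones_rot e = (Upper, w, Middle) \<longleftrightarrow> e = (Upper, w, LeftChild)"
  "jones_rot e = (Lower, w, Parent) \<longleftrightarrow> e = (Lower, w, LeftChild)"
  "jones_rot e = (Lower, w, Middle) \<longleftrightarrow> e = (Lower, w, RightChild)"
  by (cases e rule: jones_rot.cases; auto)+

lemma corner_white_child_dart:
  "\<not> corner_white (child_dart Upper v)" "corner_white (child_dart Lower v)"
  by (auto simp: child_dart_def)

lemma jones_edge_cases:
  assumes "{d, e} \<in> edges (jones_diagram (A, B))"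
  obtains (upper) v x y where "d = x \<and> e = y \<or> d = y \<and> e = x" "v \<in> carets A" "v \<noteq> []"
      "x = child_dart Upper v" "y = (Upper, v, Parent)"
  | (lower) v x y where "d = x \<and> e = y \<or> d = y \<and> e = x" "v \<in> carets B" "v \<noteq> []"
      "x = child_dart Lower v" "y = (Lower, v, Parent)"
  | (leaf) i x y where "d = x \<and> e = y \<or> d = y \<and> e = x" "i < num_leaves A"
      "x = child_dart Upper (leaves A ! i)" "y = child_dart Lower (leaves B ! i)"
  | (middle) i x y where "d = x \<and> e = y \<or> d = y \<and> e = x" "Suc i < num_leaves A"
      "x = (Upper, gap_caret A i, Middle)" "y = (Lower, gap_caret B i, Middle)"
  | (outer) x y where "d = x \<and> e = y \<or> d = y \<and> e = x" "x = (Upper, [], Parent)" "y = (Lower, [], Parent)"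
proof -
  have "edges (jones_diagram (A, B)) =
      {{child_dart Upper v, (Upper, v, Parent)} | v. v \<in> carets A - {[]}} \<union>
      {{child_dart Lower v, (Lower, v, Parent)} | v. v \<in> carets B - {[]}} \<union>
      {{child_dart Upper (leaves A ! i), child_dart Lower (leaves B ! i)} | i. i < num_leaves A} \<union>
      {{(Upper, gap_caret A i, Middle), (Lower, gap_caret B i, Middle)} | i. Suc i < num_leaves A} \<union>
      {{(Upper, [], Parent), (Lower, [], Parent)}}"
    by (simp add: jones_diagram_def)
  from assms[unfolded this] show thesis
  proof (elim UnE CollectE exE conjE)
    fix v assume "{d, e} = {child_dart Upper v, (Upper, v, Parent)}" "v \<in> carets A - {[]}"
    then show thesis by (intro upper[OF _ _ _ refl refl, of v]) (auto simp: doubleton_eq_iff)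
  next
    fix v assume "{d, e} = {child_dart Lower v, (Lower, v, Parent)}" "v \<in> carets B - {[]}"
    then show thesis by (intro lower[OF _ _ _ refl refl, of v]) (auto simp: doubleton_eq_iff)
  next
    fix i assume "{d, e} = {child_dart Upper (leaves A ! i), child_dart Lower (leaves B ! i)}"
      "i < num_leaves A"
    then show thesis by (intro leaf[OF _ _ refl refl, of i]) (auto simp: doubleton_eq_iff)
  next
    fix i assume "{d, e} = {(Upper, gap_caret A i, Middle), (Lower, gap_caret B i, Middle)}"
      "Suc i < num_leaves A"
    then show thesis by (intro middle[OF _ _ refl refl, of i]) (auto simp: doubleton_eq_iff)
  next
    assume "{d, e} \<in> {{(Upper, [], Parent), (Lower, [], Parent)}}"
    then show thesis by (intro outer[OF _ refl refl]) (auto simp: doubleton_eq_iff)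
  qed
qed

lemma jones_edge_darts:
  assumes "{d, e} \<in> edges (jones_diagram (A, B))"
    and "num_leaves A = num_leaves B" "A \<noteq> Leaf" "B \<noteq> Leaf"
  shows "d \<in> darts (jones_diagram (A, B))"
proof -
  have darts: "(Upper, w, q) \<in> darts (jones_diagram (A, B)) \<longleftrightarrow> w \<in> carets A"
    "(Lower, w, q) \<in> darts (jones_diagram (A, B)) \<longleftrightarrow> w \<in> carets B" for w q
    by (auto simp: jones_diagram_def)
  have child: "child_dart Upper v \<in> darts (jones_diagram (A, B)) \<longleftrightarrow> butlast v \<in> carets A"
    "child_dart Lower v \<in> darts (jones_diagram (A, B)) \<longleftrightarrow> butlast v \<in> carets B" for v
    by (auto simp: child_dart_def darts)
  have root: "[] \<in> carets A" "[] \<in> carets B"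
    using assms(3,4) by (cases A; cases B; simp)+
  show ?thesis
    using assms(1)
  proof (cases rule: jones_edge_cases)
    case (upper v x y)
    then show ?thesis using butlast_caret[OF upper(2,3)] by (auto simp: darts child)
  next
    case (lower v x y)
    then show ?thesis using butlast_caret[OF lower(2,3)] by (auto simp: darts child)
  next
    case (leaf i x y)
    then have "butlast (leaves A ! i) \<in> carets A" "butlast (leaves B ! i) \<in> carets B"
      using assms(2-4) by (auto intro: butlast_leaf_caret(2))
    then show ?thesis using leaf by (auto simp: child)
  next
    case (middle i x y)
    have "gap_caret A i \<in> carets A" "gap_caret B i \<in> carets B"
      using middle(2) consecutive_leaves[of i A] consecutive_leaves[of i B] assms(2) by auto
    then show ?thesis using middle by (auto simp: darts)
  next
    case (outer x y)
    then show ?thesis using root by (auto simp: darts)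
  qed
qed

lemma jones_edge_white:
  assumes "{d, e} \<in> edges (jones_diagram (A, B))"
  shows "corner_white d \<noteq> corner_white e"
  using assms
  by (cases rule: jones_edge_cases) (auto simp: corner_white_child_dart)

lemma jones_edge_color:
  assumes h: "2 * h = int p + 1"
    and num: "num_leaves A = num_leaves B" and nontrivial: "A \<noteq> Leaf" "B \<noteq> Leaf"
    and left: "\<And>i. i < num_leaves A \<Longrightarrow>
      [left_end h (leaves A ! i) = left_end h (leaves B ! i)] (mod int p)"
    and edge: "{d, jones_rot e} \<in> edges (jones_diagram (A, B))"
  shows "[corner_color h d = corner_color h e] (mod int p)"
  using edge
proof (cases rule: jones_edge_cases)
  case (upper v x y)
  from upper(1) show ?thesis
  proof (elim disjE conjE)
    assume "d = x" "jones_rot e = y"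
    then show ?thesis
      using corner_color_child_dart(1)[OF h upper(3)] upper(4,5) by (simp add: jones_rot_eq_iff)
  next
    assume "d = y" "jones_rot e = x"
    then show ?thesis
      using corner_color_rot_child_dart(1)[OF h upper(3)] upper(4,5) by simp
  qed
next
  case (lower v x y)
  from lower(1) show ?thesis
  proof (elim disjE conjE)
    assume "d = x" "jones_rot e = y"
    then show ?thesis
      using corner_color_child_dart(2)[OF h lower(3)] lower(4,5) by (simp add: jones_rot_eq_iff)
  next
    assume "d = y" "jones_rot e = x"
    then show ?thesis
      using corner_color_rot_child_dart(2)[OF h lower(3), of e] lower(4,5)
      by (simp add: cong_sym_eq)
  qed
next
  case (leaf i x y)
  let ?a = "leaves A ! i" and ?b = "leaves B ! i"
  have ne: "?a \<noteq> []" "?b \<noteq> []"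
    using leaf(2) num nontrivial butlast_leaf_caret(1)[of A ?a] butlast_leaf_caret(1)[of B ?b]
    by auto
  from leaf(1) show ?thesis
  proof (elim disjE conjE)
    assume "d = x" "jones_rot e = y"
    then have "[corner_color h d = - right_end h ?a] (mod int p)"
      "[corner_color h e = - right_end h ?b] (mod int p)"
      using leaf(3,4) corner_color_child_dart(1)[OF h ne(1)]
        corner_color_rot_child_dart(2)[OF h ne(2)] by auto
    moreover have "[- right_end h ?a = - right_end h ?b] (mod int p)"
      using cong_right_end_leaves[OF h num left leaf(2)] by (simp add: cong_minus_minus_iff)
    ultimately show ?thesis by (meson cong_sym cong_trans)
  next
    assume "d = y" "jones_rot e = x"
    then have "corner_color h d = left_end h ?b" "corner_color h e = left_end h ?a"
      using leaf(3,4) corner_color_child_dart(2)[OF h ne(2)]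
        corner_color_rot_child_dart(1)[OF h ne(1)] by auto
    then show ?thesis using cong_sym[OF left[OF leaf(2)]] by simp
  qed
next
  case (middle i x y)
  have "[left_end h (gap_caret A i @ [True]) = left_end h (gap_caret B i @ [True])] (mod int p)"
    using left[OF middle(2)] right_end_leaf(2)[OF h, of i A] right_end_leaf(2)[OF h, of i B]
      middle(2) num by simp
  moreover from this have
    "[- left_end h (gap_caret B i @ [True]) = - left_end h (gap_caret A i @ [True])] (mod int p)"
    by (simp add: cong_minus_minus_iff cong_sym)
  ultimately show ?thesis
    using middle by (auto simp: jones_rot_eq_iff)
next
  case (outer x y)
  then show ?thesis by (auto simp: jones_rot_eq_iff)
qed

theorem theorem3p8:
  fixes p :: nat and g :: "(btree \<times> btree) set"
  assumes "p \<ge> 3" and "odd p"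
    and "g \<in> colorable_subgroup p"
    and "g \<noteq> \<one>\<^bsub>thompson_F\<^esub>"
  shows "dehn_colorable p (jones_link g)"
proof -
  obtain A B where AB: "reduced_pair g = (A, B)" by fastforce
  obtain C D where g: "g \<in> carrier thompson_F" and CD: "(C, D) \<in> g"
    and cong: "\<forall>i < num_leaves C. dyadic_cong p (rho (leaves C ! i)) (rho (leaves D ! i))"
    using assms(3) by (auto simp: colorable_subgroup_def)
  note trees = reduced_pair_nontrivial[OF g assms(4) AB]
  define h where "h = (int p + 1) div 2"
  have "even (int p + 1)" using assms(2) by simp
  then have h: "2 * h = int p + 1" unfolding h_def by (rule dvd_mult_div_cancel)
  have left: "[left_end h (leaves A ! i) = left_end h (leaves B ! i)] (mod int p)"
    if "i < num_leaves A" for i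
  proof -
    have "((A, B), (C, D)) \<in> insertion\<^sup>*"
      using reduced_pair_insertion_star(3)[OF g CD] AB by simp
    then show ?thesis using insertion_star_leaves_cong[OF _ cong] cong_left_end[OF h] that by blast
  qed
  have root: "[] \<in> carets A" using trees(2) by (cases A) auto
  (* The corner under the upper root has color h, that is 1/2; it refutes triviality. *)
  have "dehn_colorable p (jones_diagram (A, B))"
  proof (rule dehn_colorable_by_corners[where col = "corner_color h" and white = corner_white
        and ?d0.0 = "(Upper, [], Middle)"])
    show "d \<in> darts (jones_diagram (A, B))" if "{d, e} \<in> edges (jones_diagram (A, B))" for d e
      using jones_edge_darts[OF that trees] .
    show "corner_white d \<noteq> corner_white e" if "{d, e} \<in> edges (jones_diagram (A, B))" for d e
      using jones_edge_white[OF that] .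
    have rot: "rot (jones_diagram (A, B)) = jones_rot" by (simp add: jones_diagram_def)
    show "corner_white (rot (jones_diagram (A, B)) d) \<noteq> corner_white d" for d
      unfolding rot by (rule corner_white_rot)
    show "[corner_color h d = corner_color h e] (mod int p)"
      if "{d, rot (jones_diagram (A, B)) e} \<in> edges (jones_diagram (A, B))" for d e
      using jones_edge_color[OF h trees left that[unfolded rot]] by simp
    show "[corner_color h d
          + corner_color h (rot (jones_diagram (A, B)) (rot (jones_diagram (A, B))
              (rot (jones_diagram (A, B)) d)))
        = corner_color h (rot (jones_diagram (A, B)) d)
          + corner_color h (rot (jones_diagram (A, B)) (rot (jones_diagram (A, B)) d))] (mod int p)"
      if "d \<in> over (jones_diagram (A, B))" for d
      unfolding rot using that by (intro corner_color_crossing[OF h]) (simp add: jones_diagram_def)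
    show "\<not> [corner_color h (Upper, [], Middle) = 0] (mod int p)"
    proof
      assume "[corner_color h (Upper, [], Middle) = 0] (mod int p)"
      then have "int p dvd h" by (simp add: cong_0_iff)
      then have "int p dvd 2 * h - int p" by simp
      then show False using h assms(1) by simp
    qed
  qed (use root in \<open>auto simp: jones_diagram_def\<close>)
  then show ?thesis by (simp add: jones_link_def AB)
qed

end
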